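(* Define integers $\xi_n$ by the power series expansion \[ \frac{(q^{31},q^{37};q^{68})_\infty}{(q^{3},q^{65};q^{68})_\infty}=\sum_{n=0}^{\infty}\xi_n q^n . \] Then $\xi_{34n+28}=0$ for every integer $n\ge 0$.
   Context: $(\lambda;q)_\infty=\prod_{n\ge0}(1-\lambda q^n)$ and $(\lambda_1,\lambda_2;q)_\infty=(\lambda_1;q)_\infty(\lambda_2;q)_\infty$, understood as formal power series in $q$ (or for $|q|<1$). Note this series equals $q^{7}/Y_7(q)$ where $Y_7(q)=q^{7}(q^{3},q^{65};q^{68})_\infty/(q^{31},q^{37};q^{68})_\infty$. *)

theory Defs
  imports "HOL-Analysis.Analysis"
begin

text \<open>
  Here \<open>a\<close> and \<open>q\<close> are formal power series, and the infinite product is the limit with respect to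
  the library's topology on formal power series (coefficientwise eventual stabilisation).
\<close>

definition qpoch_inf :: "'a::comm_ring_1 fps \<Rightarrow> 'a fps \<Rightarrow> 'a fps"
  where "qpoch_inf a q = (\<Prod>n. 1 - a * q ^ n)"

definition qpoch_inf2 :: "'a::comm_ring_1 fps \<Rightarrow> 'a fps \<Rightarrow> 'a fps \<Rightarrow> 'a fps"
  where "qpoch_inf2 a b q = qpoch_inf a q * qpoch_inf b q"

text \<open>
  \<^const>\<open>prodinf\<close> is a definite description, so we check that the product really converges.
\<close>

lemma qpoch_partial_nth_stable:
  fixes a q :: "'a::comm_ring_1 fps"
  assumes "fps_nth q 0 = 0" "k \<le> n"
  shows "fps_nth (\<Prod>i\<le>n. 1 - a * q ^ i) k = fps_nth (\<Prod>i\<le>k. 1 - a * q ^ i) k"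
  using assms(2)
proof (induction n rule: dec_induct)
  case base
  then show ?case by simp
next
  case (step n)
  have z: "fps_nth (q ^ Suc n) j = 0" if "j \<le> k" for j
  proof -
    have "j < Suc n" using that step.hyps by simp
    then show ?thesis using startsby_zero_power_prefix[OF assms(1), of "Suc n"] by blast
  qed
  have "(\<Prod>i\<le>Suc n. 1 - a * q ^ i) =
      (\<Prod>i\<le>n. 1 - a * q ^ i) - ((\<Prod>i\<le>n. 1 - a * q ^ i) * a) * q ^ Suc n"
    by (simp only: prod.atMost_Suc right_diff_distrib mult_1_right mult.assoc)
  moreover have "fps_nth (((\<Prod>i\<le>n. 1 - a * q ^ i) * a) * q ^ Suc n) k = 0"
    unfolding fps_mult_nth[of _ "q ^ Suc n"] by (intro sum.neutral) (use z in auto)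
  ultimately have "fps_nth (\<Prod>i\<le>Suc n. 1 - a * q ^ i) k = fps_nth (\<Prod>i\<le>n. 1 - a * q ^ i) k"
    by (simp only: fps_sub_nth diff_zero)
  then show ?case using step.IH by (simp only:)
qed

lemma qpoch_inf_aux:
  fixes a q :: "'a::idom fps"
  assumes "fps_nth a 0 = 0" "fps_nth q 0 = 0"
  defines "L \<equiv> Abs_fps (\<lambda>k. fps_nth (\<Prod>i\<le>k. 1 - a * q ^ i) k)"
  shows "(\<lambda>n. 1 - a * q ^ n) has_prod L" and "fps_nth L 0 = 1"
proof -
  show 1: "fps_nth L 0 = 1"
    using assms(1) by (simp add: L_def)
  have "(\<lambda>n. \<Prod>i\<le>n. 1 - a * q ^ i) \<longlonglongrightarrow> L"
  proof (rule tendsto_fpsI)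
    fix k
    show "eventually (\<lambda>n. fps_nth (\<Prod>i\<le>n. 1 - a * q ^ i) k = fps_nth L k) sequentially"
      using eventually_ge_at_top[of k]
    proof eventually_elim
      case (elim n)
      show ?case
        unfolding L_def fps_nth_Abs_fps by (rule qpoch_partial_nth_stable[OF assms(2) elim])
    qed
  qed
  moreover have "L \<noteq> 0"
    using 1 by (metis fps_zero_nth zero_neq_one)
  ultimately show "(\<lambda>n. 1 - a * q ^ n) has_prod L"
    unfolding has_prod_def raw_has_prod_def by (simp only: add_0_right simp_thms)
qed

lemma qpoch_inf_has_prod:
  fixes a q :: "'a::idom fps"
  assumes "fps_nth a 0 = 0" "fps_nth q 0 = 0"
  shows "(\<lambda>n. 1 - a * q ^ n) has_prod qpoch_inf a q"
  unfolding qpoch_inf_def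
  using qpoch_inf_aux(1)[OF assms] has_prod_unique[OF qpoch_inf_aux(1)[OF assms]] by (simp only:)

lemma qpoch_inf_nth:
  fixes a q :: "'a::idom fps"
  assumes "fps_nth a 0 = 0" "fps_nth q 0 = 0"
  shows "fps_nth (qpoch_inf a q) k = fps_nth (\<Prod>i\<le>k. 1 - a * q ^ i) k"
  unfolding qpoch_inf_def has_prod_unique[OF qpoch_inf_aux(1)[OF assms], symmetric] fps_nth_Abs_fps
  by (rule refl)

text \<open>
  The quotients considered below have integer coefficients, so that the integers
  \<open>\<xi>\<^sub>n\<close> exist and are unique.
\<close>

lemma fps_Ints_mult:
  fixes f g :: "'a::comm_ring_1 fps"
  assumes "\<And>n. fps_nth f n \<in> \<int>" "\<And>n. fps_nth g n \<in> \<int>"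
  shows "fps_nth (f * g) n \<in> \<int>"
  unfolding fps_mult_nth by (intro Ints_sum Ints_mult assms)

lemma fps_Ints_inverse:
  fixes f :: "'a::field fps"
  assumes "\<And>n. fps_nth f n \<in> \<int>" "fps_nth f 0 = 1"
  shows "fps_nth (inverse f) n \<in> \<int>"
proof (induction n rule: less_induct)
  case (less n)
  show ?case
  proof (cases n)
    case 0
    then show ?thesis using assms by simp
  next
    case (Suc m)
    have "inverse f * f = 1"
      by (rule inverse_mult_eq_1) (simp add: assms)
    then have "fps_nth (inverse f * f) n = 0"
      using Suc by simp
    then have "fps_nth (inverse f) n = - (\<Sum>i=0..m. fps_nth (inverse f) i * fps_nth f (n - i))"
      unfolding fps_mult_nth Suc by (simp add: assms eq_neg_iff_add_eq_0 add.commute)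
    also have "\<dots> \<in> \<int>"
      by (intro minus_in_Ints_iff[THEN iffD2] Ints_sum Ints_mult less assms) (use Suc in auto)
    finally show ?thesis .
  qed
qed

lemma qpoch_inf_Ints:
  assumes "0 < s" "0 < m"
  shows "fps_nth (qpoch_inf (fps_X ^ s) (fps_X ^ m) :: 'a::field_char_0 fps) n \<in> \<int>"
proof -
  have "fps_nth (\<Prod>i\<le>k. 1 - fps_X ^ s * (fps_X ^ m) ^ i :: 'a fps) n \<in> \<int>" for k n
  proof (induction k arbitrary: n)
    case 0
    then show ?case by simp
  next
    case (Suc k)
    have "fps_nth (1 - fps_X ^ s * (fps_X ^ m) ^ Suc k :: 'a fps) n \<in> \<int>" for n
      by (simp add: fps_X_power_nth flip: power_mult power_add)
    from fps_Ints_mult[OF Suc.IH this] show ?case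
      by (simp only: prod.atMost_Suc)
  qed
  then show ?thesis
    using assms by (simp add: qpoch_inf_nth)
qed

lemma ex1_int_coeffs_qpoch_quotient:
  assumes "0 < a" "0 < b" "0 < c" "0 < d" "0 < m"
  shows "\<exists>!\<xi> :: nat \<Rightarrow> int.
      qpoch_inf2 (fps_X ^ a) (fps_X ^ b) (fps_X ^ m) / qpoch_inf2 (fps_X ^ c) (fps_X ^ d) (fps_X ^ m)
        = (Abs_fps (\<lambda>n. of_int (\<xi> n)) :: rat fps)"
proof -
  let ?A = "qpoch_inf2 (fps_X ^ a) (fps_X ^ b) (fps_X ^ m) :: rat fps"
  let ?B = "qpoch_inf2 (fps_X ^ c) (fps_X ^ d) (fps_X ^ m) :: rat fps"
  have B0: "fps_nth ?B 0 = 1"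
    using assms by (simp add: qpoch_inf2_def qpoch_inf_nth)
  have "fps_nth ?A n \<in> \<int>" "fps_nth ?B n \<in> \<int>" for n
    unfolding qpoch_inf2_def by (intro fps_Ints_mult qpoch_inf_Ints assms)+
  then have "fps_nth (?A * inverse ?B) n \<in> \<int>" for n
    by (intro fps_Ints_mult fps_Ints_inverse B0)
  then have Z: "fps_nth (?A / ?B) n \<in> \<int>" for n
    using B0 by (simp add: fps_divide_unit)
  show ?thesis
  proof (rule ex1I)
    show "?A / ?B = Abs_fps (\<lambda>n. of_int \<lfloor>fps_nth (?A / ?B) n\<rfloor>)"
      using Z by (simp add: fps_eq_iff)
  next
    fix \<xi> :: "nat \<Rightarrow> int"
    assume "?A / ?B = Abs_fps (\<lambda>n. of_int (\<xi> n))"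
    then show "\<xi> = (\<lambda>n. \<lfloor>fps_nth (?A / ?B) n\<rfloor>)" by simp
  qed
qed

end

theory Submission
  imports Defs "HOL-Computational_Algebra.Formal_Laurent_Series"
begin

text \<open>
  Ramanujan's reciprocal-theta identity
  \<open>(xy, q/(xy), q, q; q)\<^sub>\<infinity> / (x, q/x, y, q/y; q)\<^sub>\<infinity> = \<Sum>\<^sub>n x\<^sup>n / (1 - y q\<^sup>n)\<close> (sum over all integers \<open>n\<close>)
  is the limit of the partial fraction decomposition in \<open>y\<close> of
  \<open>\<Prod> (1 - x y q\<^sup>k) / (1 - y q\<^sup>k)\<close> over \<open>-M \<le> k \<le> M\<close>. Taking \<open>q = X\<^bsup>68\<^esup>\<close>, \<open>x = X\<^sup>3\<close> and \<open>y = X\<^bsup>34\<^esup>\<close>,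
  it expresses the quotient as a power series in \<open>X\<^bsup>34\<^esup>\<close> times the Lambert series on the right. In that
  series the exponents congruent to 28 modulo 34 arise from \<open>n = 32 + 34 j\<close> (with sign \<open>+\<close>) and from
  \<open>n = - 2 - 34 k\<close> (with sign \<open>-\<close>), and both families give the exponents
  \<open>96 + 102 j + 2210 k + 2312 j k\<close> for \<open>j, k \<ge> 0\<close>, hence cancel.
\<close>

section \<open>Partial fractions of a product of linear quotients\<close>

text \<open>Injectivity of \<open>a\<close> makes all poles \<open>1 / a n\<close> simple; the
  constant is the limit as \<open>z\<close> tends to infinity. In the induction, the expansion for
  \<open>I\<close> is multiplied by one new quotient, and each resulting product with a pole in
  \<open>I\<close> splits into two simple poles.\<close>

lemma partial_fraction_decomposition:
  fixes a b :: "'i \<Rightarrow> 'a::field"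
  assumes "finite I" "inj_on a I" "\<And>i. i \<in> I \<Longrightarrow> a i \<noteq> 0" "\<And>i. i \<in> I \<Longrightarrow> a i * z \<noteq> 1"
  shows "(\<Prod>i\<in>I. (1 - b i * z) / (1 - a i * z)) = (\<Prod>i\<in>I. b i / a i) +
    (\<Sum>n\<in>I. (1 - b n / a n) * (\<Prod>i\<in>I - {n}. (1 - b i / a n) / (1 - a i / a n)) / (1 - a n * z))"
  using assms
proof (induction I arbitrary: z rule: finite_induct)
  case empty
  then show ?case by simp
next
  case (insert c I)
  define A where "A n = (1 - b n / a n) * (\<Prod>i\<in>I - {n}. (1 - b i / a n) / (1 - a i / a n))" for n
  have c: "a c \<noteq> 0" "a c * z \<noteq> 1" and inj: "inj_on a I"
    using insert.prems by auto
  have ne: "a n \<noteq> a c" "a n \<noteq> 0" "a n * z \<noteq> 1" if "n \<in> I" for n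
    using insert.prems insert.hyps that by (auto simp: inj_on_def)
  \<comment> \<open>The point \<open>w\<close> stays free because the expansion is needed at
    \<open>z\<close> and also at the new pole \<open>1 / a c\<close>.\<close>
  have IH: "(\<Prod>i\<in>I. (1 - b i * w) / (1 - a i * w)) = (\<Prod>i\<in>I. b i / a i) + (\<Sum>n\<in>I. A n / (1 - a n * w))"
    if "\<And>i. i \<in> I \<Longrightarrow> a i * w \<noteq> 1" for w
    unfolding A_def by (rule insert.IH[OF inj]) (use ne that in auto)
  let ?t = "(1 - b c * z) / (1 - a c * z)"
  have step: "A n / (1 - a n * z) * ?t =
      A n * ((1 - b c / a n) / (1 - a c / a n)) / (1 - a n * z)
      + (1 - b c / a c) * (A n / (1 - a n / a c)) / (1 - a c * z)" if "n \<in> I" for n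
  proof -
    have "1 - a n * z \<noteq> 0" "1 - a c * z \<noteq> 0" "a n - a c \<noteq> 0" "a c - a n \<noteq> 0"
      using ne[OF that] c by auto
    moreover have "1 - a c / a n = (a n - a c) / a n" "1 - a n / a c = (a c - a n) / a c"
      using ne[OF that] c by (auto simp: field_simps)
    ultimately have "?t / (1 - a n * z) = ((1 - b c / a n) / (1 - a c / a n)) / (1 - a n * z)
      + (1 - b c / a c) * (1 / (1 - a n / a c)) / (1 - a c * z)"
      using ne[OF that] c by (simp add: divide_simps) (simp add: algebra_simps)
    then have "A n * (?t / (1 - a n * z)) = A n * (((1 - b c / a n) / (1 - a c / a n)) / (1 - a n * z)
      + (1 - b c / a c) * (1 / (1 - a n / a c)) / (1 - a c * z))"
      by (simp only:)
    then show ?thesis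
      by (simp only: distrib_left divide_inverse mult_ac mult_1_left)
  qed
  have t: "?t = b c / a c + (1 - b c / a c) / (1 - a c * z)"
    using c by (simp add: divide_simps) (simp add: algebra_simps)
  have "(\<Prod>i\<in>insert c I. (1 - b i * z) / (1 - a i * z))
      = ((\<Prod>i\<in>I. b i / a i) + (\<Sum>n\<in>I. A n / (1 - a n * z))) * ?t"
    by (subst IH[symmetric]) (use ne(3) in \<open>auto simp: prod.insert[OF insert.hyps] mult.commute[of ?t]\<close>)
  also have "\<dots> = (\<Prod>i\<in>I. b i / a i) * (b c / a c)
      + (\<Sum>n\<in>I. A n * ((1 - b c / a n) / (1 - a c / a n)) / (1 - a n * z))
      + (1 - b c / a c) * ((\<Prod>i\<in>I. b i / a i) + (\<Sum>n\<in>I. A n / (1 - a n / a c))) / (1 - a c * z)"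
  proof -
    have "(\<Sum>n\<in>I. A n / (1 - a n * z)) * ?t =
        (\<Sum>n\<in>I. A n * ((1 - b c / a n) / (1 - a c / a n)) / (1 - a n * z)) +
        (\<Sum>n\<in>I. (1 - b c / a c) * (A n / (1 - a n / a c)) / (1 - a c * z))"
      unfolding sum_distrib_right sum.distrib[symmetric] by (rule sum.cong[OF refl step])
    also have "(\<Sum>n\<in>I. (1 - b c / a c) * (A n / (1 - a n / a c)) / (1 - a c * z)) =
        (1 - b c / a c) * (\<Sum>n\<in>I. A n / (1 - a n / a c)) / (1 - a c * z)"
      by (simp only: sum_distrib_left sum_divide_distrib)
    finally show ?thesis
      unfolding distrib_right distrib_left add_divide_distrib
      by (subst t) (simp add: distrib_left mult_ac flip: divide_inverse)
  qed
  \<comment> \<open>The contributions to the new pole add up to the induction hypothesis at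
    \<open>w = inverse (a c)\<close>, which turns them into the product required as its
    coefficient.\<close>
  also have "(\<Prod>i\<in>I. b i / a i) + (\<Sum>n\<in>I. A n / (1 - a n / a c))
      = (\<Prod>i\<in>I. (1 - b i / a c) / (1 - a i / a c))"
    using IH[of "inverse (a c)"] ne(1) c by (simp add: field_simps)
  also have "(\<Sum>n\<in>I. A n * ((1 - b c / a n) / (1 - a c / a n)) / (1 - a n * z)) =
     (\<Sum>n\<in>I. (1 - b n / a n) * (\<Prod>i\<in>insert c I - {n}. (1 - b i / a n) / (1 - a i / a n)) / (1 - a n * z))"
  proof (rule sum.cong[OF refl])
    fix n assume n: "n \<in> I"
    then have "insert c I - {n} = insert c (I - {n})" using insert.hyps by auto
    then show "A n * ((1 - b c / a n) / (1 - a c / a n)) / (1 - a n * z) =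
      (1 - b n / a n) * (\<Prod>i\<in>insert c I - {n}. (1 - b i / a n) / (1 - a i / a n)) / (1 - a n * z)"
      using insert.hyps by (simp add: A_def mult_ac)
  qed
  also have "I = insert c I - {c}" using insert.hyps by auto
  finally show ?case
    using insert.hyps by (simp add: mult_ac add_ac)
qed

section \<open>The bilateral identity in finite form\<close>

text \<open>Working in the locale gives the splitting for sums and for products at once. The
  negative indices are \<open>-(j + 1)\<close>, so that zero is counted only on the nonnegative
  side.\<close>

lemma (in comm_monoid_set) int_interval_split:
  "F g {- int s..int r} = F (\<lambda>j. g (int j)) {..r} \<^bold>* F (\<lambda>j. g (- int (Suc j))) {..<s}"
proof -
  have "{- int s..int r} = int ` {..r} \<union> (\<lambda>j. - int (Suc j)) ` {..<s}"
  proof (intro equalityI subsetI)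
    fix k assume k: "k \<in> {- int s..int r}"
    show "k \<in> int ` {..r} \<union> (\<lambda>j. - int (Suc j)) ` {..<s}"
    proof (cases "k \<ge> 0")
      case True
      then show ?thesis using k by (intro UnI1 image_eqI[of _ _ "nat k"]) auto
    next
      case False
      then show ?thesis using k by (intro UnI2 image_eqI[of _ _ "nat (- k - 1)"]) auto
    qed
  qed auto
  then show ?thesis
    by (subst \<open>_ = _\<close>, subst union_disjoint) (auto simp: reindex inj_on_def)
qed

definition qpoch :: "'a::comm_ring_1 \<Rightarrow> 'a \<Rightarrow> nat \<Rightarrow> 'a"
  where "qpoch a q n = (\<Prod>i<n. 1 - a * q ^ i)"

text \<open>
  The coefficient of \<open>1 / (1 - y q\<^sup>n)\<close> in the decomposition is \<open>x\<^sup>s\<close> times this ratio, where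
  \<open>r = M - n\<close> and \<open>s = M + n\<close>.
\<close>

definition qpoch_ratio :: "'a::field \<Rightarrow> 'a \<Rightarrow> nat \<Rightarrow> nat \<Rightarrow> 'a"
  where "qpoch_ratio x q r s = qpoch x q (Suc r) * qpoch (q / x) q s / (qpoch q q r * qpoch q q s)"

text \<open>Reflection: \<open>1 - c / q ^ Suc j = - (c / q ^ Suc j) * (1 - q / c * q ^ j)\<close>,
  used with \<open>c = x * y\<close> above and \<open>c = y\<close> below. The prefactors of each
  quotient leave a single \<open>x\<close>.\<close>

lemma prod_negative_powers_eq_qpoch:
  fixes x y q :: "'a::field"
  assumes "x \<noteq> 0" "y \<noteq> 0" "q \<noteq> 0"
  shows "(\<Prod>j<s. (1 - x * y * q powi (- int (Suc j))) / (1 - y * q powi (- int (Suc j))))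
    = x ^ s * (qpoch (q / (x * y)) q s / qpoch (q / y) q s)"
proof -
  have "(1 - x * y * q powi (- int (Suc j))) / (1 - y * q powi (- int (Suc j)))
      = x * ((1 - q / (x * y) * q ^ j) / (1 - q / y * q ^ j))" for j
  proof -
    have "1 - x * y * q powi (- int (Suc j)) = - (x * y / q ^ Suc j) * (1 - q / (x * y) * q ^ j)"
      "1 - y * q powi (- int (Suc j)) = - (y / q ^ Suc j) * (1 - q / y * q ^ j)"
      using assms unfolding power_int_minus power_int_of_nat by (simp_all add: field_simps)
    then show ?thesis using assms unfolding \<open>1 - x * y * _ = _\<close> \<open>1 - y * _ = _\<close> by simp
  qed
  then show ?thesis
    by (simp add: qpoch_def prod.distrib prod_dividef)
qed

text \<open>Partial fractions in \<open>y\<close> with \<open>a k = q powi k\<close> and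
  \<open>b k = x * q powi k\<close> for \<open>-M \<le> k \<le> M\<close>, after which
  \<open>x ^ M\<close> is cancelled. For negative indices, \<open>1 - y / q ^ Suc n\<close> is
  expressed through \<open>1 - q ^ Suc n / y\<close>; this gives the minus sign and a form that can
  be expanded as a power series.\<close>

lemma finite_lambert_identity:
  fixes x y q :: "'a::field"
  assumes nz: "x \<noteq> 0" "y \<noteq> 0" "q \<noteq> 0"
    and q: "\<And>n. q ^ Suc n \<noteq> 1" and y1: "\<And>n. y * q ^ n \<noteq> 1" and y2: "\<And>n. q ^ Suc n \<noteq> y"
  shows "qpoch (x * y) q (Suc M) * qpoch (q / (x * y)) q M / (qpoch y q (Suc M) * qpoch (q / y) q M) =
    x ^ Suc M + (\<Sum>n\<le>M. x ^ n / (1 - y * q ^ n) * qpoch_ratio x q (M - n) (M + n))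
    - (\<Sum>n<M. ((q / x) ^ Suc n / y) / (1 - q ^ Suc n / y) * qpoch_ratio x q (M + Suc n) (M - Suc n))"
proof -
  define I where "I = {- int M..int M}"
  have fin: "finite I" by (simp add: I_def)
  have q_powi: "q powi k \<noteq> 1" if "k \<noteq> 0" for k
  proof -
    have "q ^ n \<noteq> 1" if "n \<noteq> 0" for n using q[of "n - 1"] that by simp
    from this[of "nat \<bar>k\<bar>"] that show ?thesis
      by (auto simp: power_int_def power_inverse split: if_splits)
  qed
  have y_powi: "q powi k * y \<noteq> 1" for k
  proof (cases "k \<ge> 0")
    case True
    then show ?thesis using y1[of "nat k"] by (simp add: power_int_def mult.commute)
  next
    case False
    then show ?thesis using y2[of "nat (-k) - 1"] nz
      by (simp add: power_int_def field_simps)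
  qed
  have inj: "inj_on (\<lambda>k. q powi k) I"
  proof (rule inj_onI)
    fix i j assume "q powi i = q powi j"
    then have "q powi (i - j) = 1" using nz by (simp add: power_int_diff)
    then show "i = j" using q_powi[of "i - j"] by auto
  qed
  \<comment> \<open>The quotients \<open>b k / a n\<close> and \<open>a k / a n\<close> depend only
    on \<open>k - n\<close>, and \<open>1 - b n / a n\<close> is \<open>1 - x\<close> for every
    \<open>n\<close>.\<close>
  define A where "A n = (1 - x) * (\<Prod>k\<in>I - {n}. (1 - x * q powi (k - n)) / (1 - q powi (k - n)))" for n
  have pf: "(\<Prod>k\<in>I. (1 - x * y * q powi k) / (1 - y * q powi k)) =
     x ^ (2 * M + 1) + (\<Sum>n\<in>I. A n / (1 - y * q powi n))"
  proof -
    have "(\<Prod>k\<in>I. (1 - (x * q powi k) * y) / (1 - q powi k * y)) =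
       (\<Prod>k\<in>I. (x * q powi k) / q powi k) + (\<Sum>n\<in>I. (1 - (x * q powi n) / q powi n) *
       (\<Prod>k\<in>I - {n}. (1 - (x * q powi k) / q powi n) / (1 - q powi k / q powi n)) / (1 - q powi n * y))"
      by (rule partial_fraction_decomposition[OF fin inj]) (use nz y_powi in auto)
    moreover have "(\<Prod>k\<in>I. (x * q powi k) / q powi k) = x ^ (2 * M + 1)"
    proof -
      have "card I = 2 * M + 1" by (simp add: I_def)
      then show ?thesis using nz by simp
    qed
    ultimately show ?thesis
      using nz unfolding A_def power_int_diff[OF disjI1[OF nz(3)]]
      by (simp add: mult.commute[of _ y] mult.left_commute[of _ y] mult.assoc)
  qed
  have A: "A n = x ^ s * qpoch_ratio x q r s" if "int r = int M - n" "int s = int M + n" for n r s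
  proof -
    \<comment> \<open>The value 1 at \<open>0\<close> fills the gap at \<open>k = n\<close>, so that
      the product runs over a full interval and can be shifted by \<open>n\<close>.\<close>
    define g where "g k = (if k = 0 then 1 else (1 - x * q powi k) / (1 - q powi k))" for k
    have "(\<Prod>k\<in>I - {n}. (1 - x * q powi (k - n)) / (1 - q powi (k - n))) = (\<Prod>k\<in>I. g (k - n))"
      by (rule prod.mono_neutral_cong_left) (use fin in \<open>auto simp: g_def\<close>)
    also have "\<dots> = (\<Prod>k\<in>{- int s..int r}. g k)"
      by (rule prod.reindex_bij_witness[of _ "\<lambda>k. k + n" "\<lambda>k. k - n"]) (use that in \<open>auto simp: I_def\<close>)
    also have "\<dots> = (\<Prod>j\<le>r. g (int j)) * (\<Prod>j<s. g (- int (Suc j)))"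
      by (rule prod.int_interval_split)
    also have "(\<Prod>j<s. g (- int (Suc j))) = x ^ s * (qpoch (q / x) q s / qpoch q q s)"
      using prod_negative_powers_eq_qpoch[of x 1 q s] nz by (simp add: g_def)
    also have "(\<Prod>j\<le>r. g (int j)) = (\<Prod>j<r. (1 - x * q ^ Suc j) / (1 - q ^ Suc j))"
      by (simp add: g_def lessThan_Suc_atMost[symmetric] prod.lessThan_Suc_shift
          del: prod.lessThan_Suc of_nat_Suc power_Suc)
    \<comment> \<open>The factor \<open>1 - x\<close> supplies the missing first factor of
      \<open>qpoch x q (Suc r)\<close>.\<close>
    also have "(1 - x) * (\<dots> * (x ^ s * (qpoch (q / x) q s / qpoch q q s))) = x ^ s * qpoch_ratio x q r s"
      by (simp add: qpoch_ratio_def qpoch_def prod.lessThan_Suc_shift prod_dividef mult_ac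
          del: prod.lessThan_Suc)
    finally show ?thesis by (simp add: A_def)
  qed
  have "(\<Prod>k\<in>I. (1 - x * y * q powi k) / (1 - y * q powi k)) =
     (\<Prod>j\<le>M. (1 - x * y * q ^ j) / (1 - y * q ^ j)) * (x ^ M * (qpoch (q / (x * y)) q M / qpoch (q / y) q M))"
    unfolding I_def prod.int_interval_split prod_negative_powers_eq_qpoch[OF nz] by simp
  also have "\<dots> = x ^ M * (qpoch (x * y) q (Suc M) * qpoch (q / (x * y)) q M / (qpoch y q (Suc M) * qpoch (q / y) q M))"
    by (simp add: qpoch_def prod_dividef lessThan_Suc_atMost del: prod.lessThan_Suc)
  finally have L: "(\<Prod>k\<in>I. (1 - x * y * q powi k) / (1 - y * q powi k)) = \<dots>" .
  have "(\<Sum>n\<in>I. A n / (1 - y * q powi n)) = (\<Sum>n\<le>M. A (int n) / (1 - y * q ^ n))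
     + (\<Sum>n<M. A (- int (Suc n)) / (1 - y * q powi (- int (Suc n))))"
    unfolding I_def sum.int_interval_split by simp
  also have "(\<Sum>n\<le>M. A (int n) / (1 - y * q ^ n)) =
      x ^ M * (\<Sum>n\<le>M. x ^ n / (1 - y * q ^ n) * qpoch_ratio x q (M - n) (M + n))"
    unfolding sum_distrib_left
  proof (rule sum.cong[OF refl])
    fix n assume "n \<in> {..M}"
    then have "A (int n) = x ^ (M + n) * qpoch_ratio x q (M - n) (M + n)" by (intro A) auto
    then show "A (int n) / (1 - y * q ^ n) = x ^ M * (x ^ n / (1 - y * q ^ n) * qpoch_ratio x q (M - n) (M + n))"
      by (simp add: power_add)
  qed
  also have "(\<Sum>n<M. A (- int (Suc n)) / (1 - y * q powi (- int (Suc n)))) =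
     - (x ^ M) * (\<Sum>n<M. ((q / x) ^ Suc n / y) / (1 - q ^ Suc n / y) * qpoch_ratio x q (M + Suc n) (M - Suc n))"
    unfolding sum_distrib_left
  proof (rule sum.cong[OF refl])
    fix n assume n: "n \<in> {..<M}"
    then have "A (- int (Suc n)) = x ^ (M - Suc n) * qpoch_ratio x q (M + Suc n) (M - Suc n)" by (intro A) auto
    moreover have "x ^ (M - Suc n) = x ^ M / x ^ Suc n" using n nz by (intro power_diff) auto
    moreover have "1 - y * q powi (- int (Suc n)) = - (y / q ^ Suc n) * (1 - q ^ Suc n / y)"
      using nz unfolding power_int_minus power_int_of_nat by (simp add: field_simps)
    ultimately show "A (- int (Suc n)) / (1 - y * q powi (- int (Suc n))) = - (x ^ M) *
       (((q / x) ^ Suc n / y) / (1 - q ^ Suc n / y) * qpoch_ratio x q (M + Suc n) (M - Suc n))"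
      by (simp only: power_divide) (simp add: mult_ac)
  qed
  finally have "x ^ M * (qpoch (x * y) q (Suc M) * qpoch (q / (x * y)) q M / (qpoch y q (Suc M) * qpoch (q / y) q M))
    = x ^ M * (x ^ Suc M + (\<Sum>n\<le>M. x ^ n / (1 - y * q ^ n) * qpoch_ratio x q (M - n) (M + n))
    - (\<Sum>n<M. ((q / x) ^ Suc n / y) / (1 - q ^ Suc n / y) * qpoch_ratio x q (M + Suc n) (M - Suc n)))"
    using pf unfolding L by (simp add: distrib_left right_diff_distrib mult_2 power_add mult.assoc)
  then show ?thesis by (simp only: mult_cancel_left power_not_zero[OF nz(1)] simp_thms)
qed

section \<open>Transfer from Laurent series to power series\<close>

lemma fps_nth_0_qpoch [simp]:
  "fps_nth a 0 = 0 \<Longrightarrow> fps_nth (qpoch a q n) 0 = (1 :: 'a::comm_ring_1)"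
  by (induction n) (simp_all add: qpoch_def)

lemma fps_to_fls_qpoch:
  "fps_to_fls (qpoch a q n) = qpoch (fps_to_fls a) (fps_to_fls q) n" for a :: "'a::comm_ring_1 fps"
  by (induction n) (simp_all add: qpoch_def fls_times_fps_to_fls fps_to_fls_power)

lemma fps_to_fls_sum:
  fixes f :: "'i \<Rightarrow> 'a::comm_monoid_add fps"
  shows "fps_to_fls (sum f A) = (\<Sum>i\<in>A. fps_to_fls (f i))"
  by (induction A rule: infinite_finite_induct) simp_all

lemma fps_to_fls_inverse:
  fixes f :: "'a::field fps"
  shows "fps_nth f 0 \<noteq> 0 \<Longrightarrow> fps_to_fls (inverse f) = inverse (fps_to_fls f)"
  by (rule fls_inverse_fps_to_fls[symmetric]) (simp add: subdegree_eq_0_iff)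

text \<open>The power series counterpart of \<open>qpoch_ratio\<close> for \<open>x = X^a\<close>
  and \<open>q = X^m\<close>. The quotient \<open>q / x\<close> becomes
  \<open>fps_X ^ (m - a)\<close>, which is faithful for \<open>a \<le> m\<close>.\<close>

definition fps_qpoch_ratio :: "nat \<Rightarrow> nat \<Rightarrow> nat \<Rightarrow> nat \<Rightarrow> 'a::field fps"
  where "fps_qpoch_ratio a m r s =
    qpoch (fps_X ^ a) (fps_X ^ m) (Suc r) * qpoch (fps_X ^ (m - a)) (fps_X ^ m) s
      * inverse (qpoch (fps_X ^ m) (fps_X ^ m) r * qpoch (fps_X ^ m) (fps_X ^ m) s)"

lemma fls_X_power_div: "d \<le> c \<Longrightarrow> fls_X ^ c / fls_X ^ d = (fls_X ^ (c - d) :: 'a::field fls)"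
  by (simp add: power_diff)

lemma fls_X_power_neq: "c \<noteq> d \<Longrightarrow> fls_X ^ c \<noteq> (fls_X ^ d :: 'a::field fls)"
proof
  assume cd: "c \<noteq> d" and "fls_X ^ c = (fls_X ^ d :: 'a fls)"
  then have "fps_to_fls (fps_X ^ c) = fps_to_fls (fps_X ^ d :: 'a fps)"
    by (simp add: fps_to_fls_power)
  then have "fps_nth (fps_X ^ c :: 'a fps) c = fps_nth (fps_X ^ d) c"
    by (simp only: fps_to_fls_eq_iff)
  with cd show False by simp
qed

text \<open>The finite identity needs a field, so it is instantiated in Laurent series and pulled
  back along the injective \<open>fps_to_fls\<close>. The bound \<open>a + b < m\<close> keeps all
  exponents nonnegative and all denominators invertible as power series.\<close>

lemma fps_finite_lambert_identity:
  assumes ab: "0 < a" "0 < b" "a + b < m"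
  shows "qpoch (fps_X ^ (a + b)) (fps_X ^ m) (Suc M) * qpoch (fps_X ^ (m - (a + b))) (fps_X ^ m) M
      * inverse (qpoch (fps_X ^ b) (fps_X ^ m) (Suc M) * qpoch (fps_X ^ (m - b)) (fps_X ^ m) M) =
    (fps_X ^ (a * Suc M) :: 'a::field fps)
    + (\<Sum>n\<le>M. fps_X ^ (a * n) * inverse (1 - fps_X ^ (b + m * n)) * fps_qpoch_ratio a m (M - n) (M + n))
    - (\<Sum>n<M. fps_X ^ ((m - a) * Suc n - b) * inverse (1 - fps_X ^ (m * Suc n - b))
        * fps_qpoch_ratio a m (M + Suc n) (M - Suc n))"
    (is "?l = ?c + ?s1 - ?s2")
proof -
  define x y q :: "'a fls" where "x = fls_X ^ a" and "y = fls_X ^ b" and "q = fls_X ^ m"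
  have xyq: "x \<noteq> 0" "y \<noteq> 0" "q \<noteq> 0" by (simp_all add: x_def y_def q_def)
  have qp: "q ^ n = fls_X ^ (m * n)" for n by (simp add: q_def power_mult)
  \<comment> \<open>These bounds make the truncated subtractions in the exponents exact.\<close>
  have le: "b \<le> (m - a) * Suc n" "b \<le> m * Suc n" for n
    using ab mult_le_mono[of b "m - a" 1 "Suc n"] mult_le_mono[of b m 1 "Suc n"] by auto
  have quots: "q / (x * y) = fls_X ^ (m - (a + b))" "q / y = fls_X ^ (m - b)" "q / x = fls_X ^ (m - a)"
    "x * y = fls_X ^ (a + b)"
    using ab unfolding x_def y_def q_def power_add[symmetric] by (simp_all only: fls_X_power_div)
  have hom: "fps_to_fls (qpoch (fps_X ^ c) (fps_X ^ m) r) = qpoch (fls_X ^ c) q r" for c r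
    by (simp only: fps_to_fls_qpoch fps_to_fls_power fps_X_to_fls q_def)
  have hom_inv: "fps_to_fls (inverse (qpoch (fps_X ^ c) (fps_X ^ m) r * qpoch (fps_X ^ d) (fps_X ^ m) s))
      = inverse (qpoch (fls_X ^ c) q r * qpoch (fls_X ^ d) q s)" if "0 < c" "0 < d" for c d r s
    using that by (subst fps_to_fls_inverse) (simp_all only: fls_times_fps_to_fls hom, simp)
  have B: "fps_to_fls (fps_qpoch_ratio a m r s) = qpoch_ratio x q r s" for r s
    unfolding fps_qpoch_ratio_def qpoch_ratio_def quots unfolding divide_inverse
    using ab by (simp only: fls_times_fps_to_fls hom hom_inv x_def q_def[symmetric])
  have "fps_to_fls ?l = qpoch (x * y) q (Suc M) * qpoch (q / (x * y)) q M
       / (qpoch y q (Suc M) * qpoch (q / y) q M)"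
    unfolding quots(1-3) unfolding quots(4) divide_inverse
    using ab by (simp only: fls_times_fps_to_fls hom hom_inv y_def zero_less_diff)
  also have "\<dots> = x ^ Suc M + (\<Sum>n\<le>M. x ^ n / (1 - y * q ^ n) * qpoch_ratio x q (M - n) (M + n))
    - (\<Sum>n<M. ((q / x) ^ Suc n / y) / (1 - q ^ Suc n / y) * qpoch_ratio x q (M + Suc n) (M - Suc n))"
  proof (rule finite_lambert_identity[OF xyq])
    show "q ^ Suc n \<noteq> 1" for n
      unfolding qp using fls_X_power_neq[of "m * Suc n" 0] ab by simp
    show "y * q ^ n \<noteq> 1" for n
      unfolding qp y_def power_add[symmetric] using fls_X_power_neq[of "b + m * n" 0] ab by simp
    show "q ^ Suc n \<noteq> y" for n
      unfolding qp y_def using ab mult_le_mono[of m m 1 "Suc n"] by (intro fls_X_power_neq) simp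
  qed
  also have "x ^ Suc M = fps_to_fls ?c"
    by (simp only: x_def power_mult[symmetric] fps_to_fls_power fps_X_to_fls)
  also have "(\<Sum>n\<le>M. x ^ n / (1 - y * q ^ n) * qpoch_ratio x q (M - n) (M + n)) = fps_to_fls ?s1"
  proof -
    have "fps_to_fls (fps_X ^ (a * n) * inverse (1 - fps_X ^ (b + m * n)) * fps_qpoch_ratio a m (M - n) (M + n))
      = x ^ n / (1 - y * q ^ n) * qpoch_ratio x q (M - n) (M + n)" for n
    proof -
      have "fps_nth (1 - fps_X ^ (b + m * n) :: 'a fps) 0 \<noteq> 0" using ab by simp
      from fps_to_fls_inverse[OF this] show ?thesis
        by (simp only: fls_times_fps_to_fls B fps_to_fls_minus fps_one_to_fls
            fps_to_fls_power fps_X_to_fls divide_inverse qp x_def y_def power_add[symmetric] power_mult[symmetric])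
    qed
    then show ?thesis by (simp add: fps_to_fls_sum)
  qed
  also have "(\<Sum>n<M. ((q / x) ^ Suc n / y) / (1 - q ^ Suc n / y) * qpoch_ratio x q (M + Suc n) (M - Suc n))
     = fps_to_fls ?s2"
  proof -
    have "fps_to_fls (fps_X ^ ((m - a) * Suc n - b) * inverse (1 - fps_X ^ (m * Suc n - b))
        * fps_qpoch_ratio a m (M + Suc n) (M - Suc n))
      = ((q / x) ^ Suc n / y) / (1 - q ^ Suc n / y) * qpoch_ratio x q (M + Suc n) (M - Suc n)" for n
    proof -
      have pos: "m * Suc n - b > 0" using ab mult_le_mono[of m m 1 "Suc n"] by simp
      have "(q / x) ^ Suc n / y = fls_X ^ ((m - a) * Suc n - b)"
        unfolding quots power_mult[symmetric] y_def by (rule fls_X_power_div[OF le(1)])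
      moreover have "q ^ Suc n / y = fls_X ^ (m * Suc n - b)"
        unfolding qp y_def by (rule fls_X_power_div[OF le(2)])
      moreover have "fps_nth (1 - fps_X ^ (m * Suc n - b) :: 'a fps) 0 \<noteq> 0" using pos by simp
      note fps_to_fls_inverse[OF this]
      ultimately show ?thesis
        by (simp only: fls_times_fps_to_fls B fps_to_fls_minus fps_one_to_fls
            fps_to_fls_power fps_X_to_fls divide_inverse)
    qed
    then show ?thesis by (simp add: fps_to_fls_sum del: mult_Suc_right power_Suc)
  qed
  finally show ?thesis
    by (simp only: fps_to_fls_plus[symmetric] fps_to_fls_minus[symmetric] fps_to_fls_eq_iff)
qed

section \<open>Truncation of power series and of infinite products\<close>

lemma fps_cutoff_mult_cong:
  fixes f g :: "'a::semiring_0 fps"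
  assumes "fps_cutoff n f = fps_cutoff n f'" "fps_cutoff n g = fps_cutoff n g'"
  shows "fps_cutoff n (f * g) = fps_cutoff n (f' * g')"
  using assms unfolding fps_cutoff_eq_fps_cutoff_iff by (auto simp: fps_mult_nth intro!: sum.cong)

lemma fps_cutoff_inverse_cong:
  fixes f g :: "'a::field fps"
  assumes "fps_cutoff n f = fps_cutoff n g" "fps_nth f 0 \<noteq> 0" "fps_nth g 0 \<noteq> 0"
  shows "fps_cutoff n (inverse f) = fps_cutoff n (inverse g)"
  using fps_cutoff_inverse[of f n] fps_cutoff_inverse[of g n] assms by simp

text \<open>Since \<open>q\<close> has zero constant term, factors of index at least
  \<open>n\<close> leave the coefficients below \<open>n\<close> unchanged.\<close>

lemma fps_cutoff_qpoch:
  fixes a q :: "'a::idom fps"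
  assumes "fps_nth a 0 = 0" "fps_nth q 0 = 0" "n \<le> r"
  shows "fps_cutoff n (qpoch a q r) = fps_cutoff n (qpoch_inf a q)"
  unfolding fps_cutoff_eq_fps_cutoff_iff
proof (intro allI impI)
  fix k assume "k < n"
  then obtain r' where r': "r = Suc r'" "k \<le> r'"
    using assms(3) by (cases r) auto
  show "fps_nth (qpoch a q r) k = fps_nth (qpoch_inf a q) k"
    unfolding qpoch_def r'(1) lessThan_Suc_atMost qpoch_inf_nth[OF assms(1,2)]
    by (rule qpoch_partial_nth_stable[OF assms(2) r'(2)])
qed

lemma fps_nth_0_qpoch_inf:
  fixes a q :: "'a::idom fps"
  assumes "fps_nth a 0 = 0" "fps_nth q 0 = 0"
  shows "fps_nth (qpoch_inf a q) 0 = 1"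
  using assms by (simp add: qpoch_inf_nth)

section \<open>Geometric series and the Lambert series\<close>

text \<open>Because \<open>d\<close> is positive, at most one \<open>k\<close> fits, so every
  coefficient is 0 or 1. The inverse is found by exhibiting \<open>G\<close>, the indicator series
  of the multiples of \<open>d\<close>.\<close>

lemma fps_nth_geometric:
  assumes "0 < d"
  shows "fps_nth (fps_X ^ c * inverse (1 - fps_X ^ d)) N = (if \<exists>k. N = c + d * k then 1 else (0 :: 'a::field))"
proof -
  define G :: "'a fps" where "G = Abs_fps (\<lambda>n. if d dvd n then 1 else 0)"
  have "G * (1 - fps_X ^ d) = 1"
  proof (rule fps_ext)
    fix n
    have "d dvd n \<longleftrightarrow> d dvd (n - d)" if "\<not> n < d" using that by (simp add: dvd_minus_self)
    moreover have "d dvd n \<longleftrightarrow> n = 0" if "n < d" using that by auto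
    ultimately show "fps_nth (G * (1 - fps_X ^ d)) n = fps_nth 1 n"
      using assms by (auto simp: G_def right_diff_distrib fps_X_power_mult_right_nth)
  qed
  then have "inverse (1 - fps_X ^ d) = G"
    using assms by (intro fps_inverse_unique) (simp add: mult.commute)
  then show ?thesis
    by (auto simp: fps_X_power_mult_nth G_def dvd_def) (metis le_add_diff_inverse not_less)+
qed

text \<open>
  The expansion of \<open>\<Sum>\<^sub>n x\<^sup>n / (1 - y q\<^sup>n)\<close> for \<open>x = X\<^sup>a\<close>, \<open>y = X\<^sup>b\<close>, \<open>q = X\<^sup>m\<close>; the second cardinality
  collects the terms with negative \<open>n\<close>, expanded in powers of \<open>(y q\<^sup>n)\<^sup>-\<^sup>1\<close>.
\<close>

definition lambert :: "nat \<Rightarrow> nat \<Rightarrow> nat \<Rightarrow> 'a::ring_1 fps"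
  where "lambert a b m = Abs_fps (\<lambda>N.
    of_nat (card {(n, k). a * n + b * k + m * n * k = N})
    - of_nat (card {(n, k). m * Suc n * Suc k = N + a * Suc n + b * Suc k}))"

text \<open>Each summand is a geometric series whose leading exponent is at least \<open>n\<close>.
  Hence the summands with \<open>n < K\<close> already account for all solutions counted at degree
  \<open>N\<close>.\<close>

lemma fps_nth_lambert_partial:
  assumes ab: "0 < a" "0 < b" "a + b < m" and N: "N < K"
  shows "fps_nth ((\<Sum>n<K. fps_X ^ (a * n) * inverse (1 - fps_X ^ (b + m * n)))
    - (\<Sum>n<K. fps_X ^ ((m - a) * Suc n - b) * inverse (1 - fps_X ^ (m * Suc n - b)))) N
    = fps_nth (lambert a b m :: 'a::field fps) N"
proof -
  \<comment> \<open>Substituting for \<open>m\<close> removes the truncated subtractions.\<close>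
  obtain c where c: "m = a + b + c" "0 < c"
    using ab(3) less_imp_add_positive by blast
  have e: "(m - a) * Suc n - b = b * n + c * Suc n" "m * Suc n - b = a * Suc n + b * n + c * Suc n" for n
    using c by (simp_all add: algebra_simps)
  \<comment> \<open>The bound on \<open>f\<close> forces \<open>n \<le> N < K\<close>; positivity of
    \<open>g\<close> lets \<open>n\<close> determine \<open>k\<close>, so counting the
    \<open>n\<close> amounts to counting the pairs.\<close>
  have count: "(\<Sum>n<K. fps_nth (fps_X ^ f n * inverse (1 - fps_X ^ g n)) N) =
      (of_nat (card {(n, k). N = f n + g n * k}) :: 'a)"
    if g: "\<And>n. 0 < g n" and f: "\<And>n. n \<le> f n" for f g :: "nat \<Rightarrow> nat"
  proof -
    have "(\<Sum>n<K. fps_nth (fps_X ^ f n * inverse (1 - fps_X ^ g n)) N) =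
       (of_nat (card ({..<K} \<inter> {n. \<exists>k. N = f n + g n * k})) :: 'a)"
      by (simp add: fps_nth_geometric[OF g] sum.If_cases)
    also have "{..<K} \<inter> {n. \<exists>k. N = f n + g n * k} = fst ` {(n, k). N = f n + g n * k}"
    proof -
      have "n < K" if "N = f n + g n * k" for n k using f[of n] N that by simp
      then show ?thesis by (force simp: image_iff)
    qed
    also have "card \<dots> = card {(n, k). N = f n + g n * k}"
    proof -
      have "g n \<noteq> 0" for n using g[of n] by simp
      then show ?thesis by (intro card_image inj_onI) (auto simp: \<open>\<And>n. g n \<noteq> 0\<close>)
    qed
    finally show ?thesis .
  qed
  have "(\<Sum>n<K. fps_nth (fps_X ^ (a * n) * inverse (1 - fps_X ^ (b + m * n))) N) =
     (of_nat (card {(n, k). N = a * n + (b + m * n) * k}) :: 'a)"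
    by (rule count) (use ab in auto)
  also have "{(n, k). N = a * n + (b + m * n) * k} = {(n, k). a * n + b * k + m * n * k = N}"
    by (auto simp: algebra_simps)
  finally have 1: "(\<Sum>n<K. fps_nth (fps_X ^ (a * n) * inverse (1 - fps_X ^ (b + m * n))) N) =
    (of_nat (card \<dots>) :: 'a)" .
  have "(\<Sum>n<K. fps_nth (fps_X ^ ((m - a) * Suc n - b) * inverse (1 - fps_X ^ (m * Suc n - b))) N) =
     (of_nat (card {(n, k). N = (m - a) * Suc n - b + (m * Suc n - b) * k}) :: 'a)"
  proof (rule count)
    show "0 < m * Suc n - b" for n using ab unfolding e by simp
    show "n \<le> (m - a) * Suc n - b" for n
      unfolding e using ab by (simp add: trans_le_add1)
  qed
  also have "{(n, k). N = (m - a) * Suc n - b + (m * Suc n - b) * k} =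
      {(n, k). m * Suc n * Suc k = N + a * Suc n + b * Suc k}"
    unfolding e c(1) by (auto simp: algebra_simps)
  finally show ?thesis
    by (simp only: fps_sub_nth fps_sum_nth 1 lambert_def fps_nth_Abs_fps)
qed

section \<open>The limit of the finite identity\<close>

text \<open>Coefficientwise limit of the finite identity, with denominators cleared at the end. At a
  fixed degree, the isolated power of \<open>x\<close> and the terms of large index vanish, while in
  the remaining terms the ratio can be replaced by its limit \<open>B\<close>.\<close>

theorem lambert_series_identity:
  assumes ab: "0 < a" "0 < b" "a + b < m"
  defines "q \<equiv> fps_X ^ m"
  shows "qpoch_inf2 (fps_X ^ (a + b)) (fps_X ^ (m - (a + b))) q * qpoch_inf q q ^ 2 =
    qpoch_inf2 (fps_X ^ a) (fps_X ^ (m - a)) q * qpoch_inf2 (fps_X ^ b) (fps_X ^ (m - b)) q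
      * (lambert a b m :: 'a::field fps)"
proof -
  define B :: "'a fps" where "B = qpoch_inf2 (fps_X ^ a) (fps_X ^ (m - a)) q * inverse (qpoch_inf q q * qpoch_inf q q)"
  have cut: "fps_cutoff K (qpoch (fps_X ^ c) q r) = fps_cutoff K (qpoch_inf (fps_X ^ c) q :: 'a fps)"
    if "0 < c" "K \<le> r" for c K r
    using that ab by (intro fps_cutoff_qpoch) (simp_all add: q_def)
  have z: "fps_nth (qpoch_inf (fps_X ^ c) q :: 'a fps) 0 = 1" "fps_nth (qpoch (fps_X ^ c) q r :: 'a fps) 0 = 1" if "0 < c" for c r
    using that ab by (simp_all add: q_def fps_nth_0_qpoch_inf)
  have zq: "fps_nth (qpoch_inf q q :: 'a fps) 0 = 1" "fps_nth (qpoch q q r :: 'a fps) 0 = 1" for r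
    using z[of m] ab by (simp_all add: q_def)
  have cutB: "fps_cutoff K (fps_qpoch_ratio a m r s) = fps_cutoff K B" if "K \<le> r" "K \<le> s" for K r s
    unfolding fps_qpoch_ratio_def B_def qpoch_inf2_def q_def[symmetric]
    using that ab cut[of m] by (intro fps_cutoff_mult_cong fps_cutoff_inverse_cong cut)
      (auto simp: zq q_def[symmetric])
  have "qpoch_inf2 (fps_X ^ (a + b)) (fps_X ^ (m - (a + b))) q
      * inverse (qpoch_inf2 (fps_X ^ b) (fps_X ^ (m - b)) q) = B * lambert a b m"
    (is "?l = _")
  proof (rule fps_ext)
    fix N
    define K where "K = Suc N"
    \<comment> \<open>With \<open>M = 2 * K\<close>, all of \<open>M - n\<close>,
      \<open>M + n\<close>, \<open>M - Suc n\<close> and \<open>M + Suc n\<close> are at least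
      \<open>K\<close> for \<open>n < K\<close>, as \<open>cutB\<close> requires.\<close>
    define M where "M = 2 * K"
    define s t :: "nat \<Rightarrow> 'a fps" where
      "s n = fps_X ^ (a * n) * inverse (1 - fps_X ^ (b + m * n))" and
      "t n = fps_X ^ ((m - a) * Suc n - b) * inverse (1 - fps_X ^ (m * Suc n - b))" for n
    have "fps_cutoff K ?l = fps_cutoff K
       (qpoch (fps_X ^ (a + b)) q (Suc M) * qpoch (fps_X ^ (m - (a + b))) q M
      * inverse (qpoch (fps_X ^ b) q (Suc M) * qpoch (fps_X ^ (m - b)) q M))"
      unfolding qpoch_inf2_def
      using ab by (intro fps_cutoff_mult_cong fps_cutoff_inverse_cong cut[symmetric]) (auto simp: z M_def)
    then have "fps_nth ?l N = fps_nth
       (qpoch (fps_X ^ (a + b)) q (Suc M) * qpoch (fps_X ^ (m - (a + b))) q M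
      * inverse (qpoch (fps_X ^ b) q (Suc M) * qpoch (fps_X ^ (m - b)) q M)) N"
      unfolding fps_cutoff_eq_fps_cutoff_iff by (simp add: K_def)
    also have "\<dots> = fps_nth (fps_X ^ (a * Suc M)) N
      + (\<Sum>n\<le>M. fps_nth (s n * fps_qpoch_ratio a m (M - n) (M + n)) N)
      - (\<Sum>n<M. fps_nth (t n * fps_qpoch_ratio a m (M + Suc n) (M - Suc n)) N)"
      unfolding q_def fps_finite_lambert_identity[OF ab] s_def t_def
      by (simp only: fps_add_nth fps_sub_nth fps_sum_nth)
    also have "fps_nth (fps_X ^ (a * Suc M)) N = (0 :: 'a)"
    proof -
      have "N < a * Suc M" using ab mult_le_mono[of 1 a "Suc M" "Suc M"] by (simp add: M_def K_def)
      then show ?thesis by simp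
    qed
    also have "(\<Sum>n\<le>M. fps_nth (s n * fps_qpoch_ratio a m (M - n) (M + n)) N) = (\<Sum>n<K. fps_nth (s n * B) N)"
    proof (rule sum.mono_neutral_cong_right)
      show "\<forall>n\<in>{..M} - {..<K}. fps_nth (s n * fps_qpoch_ratio a m (M - n) (M + n)) N = 0"
      proof
        fix n assume "n \<in> {..M} - {..<K}"
        then have "N < n" by (simp add: K_def)
        also have "n \<le> a * n" using ab by simp
        finally show "fps_nth (s n * fps_qpoch_ratio a m (M - n) (M + n)) N = 0"
          by (simp add: s_def mult.assoc fps_X_power_mult_nth)
      qed
    next
      fix n assume "n \<in> {..<K}"
      then have "fps_cutoff K (s n * fps_qpoch_ratio a m (M - n) (M + n)) = fps_cutoff K (s n * B)"
        by (intro fps_cutoff_mult_cong cutB) (auto simp: M_def)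
      then show "fps_nth (s n * fps_qpoch_ratio a m (M - n) (M + n)) N = fps_nth (s n * B) N"
        unfolding fps_cutoff_eq_fps_cutoff_iff by (simp add: K_def)
    qed (auto simp: M_def)
    also have "(\<Sum>n<M. fps_nth (t n * fps_qpoch_ratio a m (M + Suc n) (M - Suc n)) N) = (\<Sum>n<K. fps_nth (t n * B) N)"
    proof (rule sum.mono_neutral_cong_right)
      show "\<forall>n\<in>{..<M} - {..<K}. fps_nth (t n * fps_qpoch_ratio a m (M + Suc n) (M - Suc n)) N = 0"
      proof
        fix n assume "n \<in> {..<M} - {..<K}"
        \<comment> \<open>The middle term equals \<open>b * n + n + 1\<close>, and
          \<open>Suc b \<le> m - a\<close> bounds it by the exponent in \<open>t n\<close>.\<close>
        then have "N < Suc b * Suc n - b" by (simp add: K_def)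
        also have "\<dots> \<le> (m - a) * Suc n - b" using ab by (intro diff_le_mono mult_le_mono) auto
        finally show "fps_nth (t n * fps_qpoch_ratio a m (M + Suc n) (M - Suc n)) N = 0"
          by (simp only: t_def mult.assoc fps_X_power_mult_nth if_True)
      qed
    next
      fix n assume "n \<in> {..<K}"
      then have "fps_cutoff K (t n * fps_qpoch_ratio a m (M + Suc n) (M - Suc n)) = fps_cutoff K (t n * B)"
        by (intro fps_cutoff_mult_cong cutB) (auto simp: M_def)
      then show "fps_nth (t n * fps_qpoch_ratio a m (M + Suc n) (M - Suc n)) N = fps_nth (t n * B) N"
        unfolding fps_cutoff_eq_fps_cutoff_iff by (simp add: K_def)
    qed (auto simp: M_def)
    also have "0 + (\<Sum>n<K. fps_nth (s n * B) N) - (\<Sum>n<K. fps_nth (t n * B) N) =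
        fps_nth (B * ((\<Sum>n<K. s n) - (\<Sum>n<K. t n))) N"
      by (simp add: right_diff_distrib sum_distrib_left fps_sum_nth mult.commute)
    also have "fps_cutoff K (B * ((\<Sum>n<K. s n) - (\<Sum>n<K. t n))) = fps_cutoff K (B * lambert a b m)"
    proof (rule fps_cutoff_mult_cong[OF refl])
      show "fps_cutoff K ((\<Sum>n<K. s n) - (\<Sum>n<K. t n)) = fps_cutoff K (lambert a b m)"
        unfolding fps_cutoff_eq_fps_cutoff_iff s_def t_def
        using fps_nth_lambert_partial[OF ab] by blast
    qed
    then have "fps_nth (B * ((\<Sum>n<K. s n) - (\<Sum>n<K. t n))) N = fps_nth (B * lambert a b m) N"
      unfolding fps_cutoff_eq_fps_cutoff_iff by (simp add: K_def)
    finally show "fps_nth ?l N = fps_nth (B * lambert a b m) N" .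
  qed
  moreover have "inverse f * f = 1" if "fps_nth f 0 = 1" for f :: "'a fps"
    using that by (intro inverse_mult_eq_1) simp
  moreover have "fps_nth (qpoch_inf2 (fps_X ^ b) (fps_X ^ (m - b)) q :: 'a fps) 0 = 1"
    "fps_nth (qpoch_inf q q * qpoch_inf q q :: 'a fps) 0 = 1"
    using ab by (simp_all add: qpoch_inf2_def z zq)
  moreover have "P * J = A * D * L"
    if "P * inverse D = (A * inverse J) * L" "inverse D * D = 1" "inverse J * J = 1" for P A D J L :: "'a fps"
  proof -
    have "P * J = (P * inverse D) * D * J" using that(2) by (simp add: mult.assoc)
    also have "\<dots> = A * D * L * (inverse J * J)" unfolding that(1) by (simp only: mult_ac)
    finally show ?thesis using that(3) by simp
  qed
  ultimately show ?thesis unfolding B_def power2_eq_square by blast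
qed

section \<open>Vanishing of coefficients in a residue class\<close>

text \<open>Multiplying by a series in \<open>X^d\<close> does not mix residue classes of exponents:
  where \<open>g\<close> contributes, \<open>d\<close> divides \<open>n - i\<close>, so
  \<open>i\<close> lies in the class of \<open>n\<close>.\<close>

lemma fps_mult_nth_residue_zero:
  fixes f g :: "'a::comm_ring_1 fps"
  assumes f: "\<And>n. n mod d = r \<Longrightarrow> fps_nth f n = 0" and g: "\<And>n. \<not> d dvd n \<Longrightarrow> fps_nth g n = 0"
    and n: "n mod d = r"
  shows "fps_nth (f * g) n = 0"
  unfolding fps_mult_nth
proof (intro sum.neutral ballI)
  fix i assume "i \<in> {0..n}"
  then show "fps_nth f i * fps_nth g (n - i) = 0"
    using f[of i] g[of "n - i"] n mod_eq_dvd_iff_nat[of i n d] by fastforce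
qed

text \<open>By strong induction, all terms of the convolution at \<open>n\<close> vanish except
  \<open>f n * g 0\<close>, and \<open>g 0\<close> can be cancelled.\<close>

lemma fps_nth_residue_zero_cancel:
  fixes f g :: "'a::idom fps"
  assumes fg: "\<And>n. n mod d = r \<Longrightarrow> fps_nth (f * g) n = 0"
    and g: "\<And>n. \<not> d dvd n \<Longrightarrow> fps_nth g n = 0" "fps_nth g 0 \<noteq> 0"
  shows "n mod d = r \<Longrightarrow> fps_nth f n = 0"
proof (induction n rule: less_induct)
  case (less n)
  have "fps_nth f i * fps_nth g (n - i) = 0" if "i < n" for i
    using less.IH[of i] g(1)[of "n - i"] less.prems that mod_eq_dvd_iff_nat[of i n d] by fastforce
  then have "(\<Sum>i<n. fps_nth f i * fps_nth g (n - i)) = 0"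
    by (intro sum.neutral) simp
  then have "fps_nth (f * g) n = fps_nth f n * fps_nth g 0"
    by (simp add: fps_mult_nth atLeast0AtMost lessThan_Suc_atMost[symmetric])
  then show ?case using fg[OF less.prems] g(2) by simp
qed

lemma fps_nth_mult_not_dvd:
  fixes f g :: "'a::comm_ring_1 fps"
  assumes "\<And>n. \<not> d dvd n \<Longrightarrow> fps_nth f n = 0" "\<And>n. \<not> d dvd n \<Longrightarrow> fps_nth g n = 0" "\<not> d dvd n"
  shows "fps_nth (f * g) n = 0"
  by (rule fps_mult_nth_residue_zero[OF _ assms(2) refl])
    (use assms(1,3) in \<open>auto simp: dvd_eq_mod_eq_0\<close>)

lemma fps_nth_qpoch_inf_not_dvd:
  assumes "0 < c" "0 < m" "d dvd c" "d dvd m" "\<not> d dvd n"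
  shows "fps_nth (qpoch_inf (fps_X ^ c) (fps_X ^ m) :: 'a::idom fps) n = 0"
proof -
  have "fps_nth (\<Prod>i\<le>k. 1 - fps_X ^ c * (fps_X ^ m) ^ i :: 'a fps) n = 0" if "\<not> d dvd n" for k n
    using that
  proof (induction k arbitrary: n)
    case 0
    then show ?case using assms by (cases "n = 0") auto
  next
    case (Suc k)
    have "fps_nth (1 - fps_X ^ c * (fps_X ^ m) ^ Suc k :: 'a fps) n = 0" if "\<not> d dvd n" for n
      using that assms(3,4) by (cases "n = 0") (auto simp flip: power_mult power_add)
    then show ?case
      unfolding prod.atMost_Suc by (intro fps_nth_mult_not_dvd[where d = d] Suc)
  qed
  then show ?thesis using assms by (simp add: qpoch_inf_nth)
qed

section \<open>Cancellation at the exponents 28 modulo 34\<close>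

text \<open>Modulo 34 the equations force \<open>n = 32 + 34 * j\<close> in \<open>?A\<close> and
  \<open>n = 1 + 34 * j\<close> in \<open>?B\<close>. The maps \<open>?g\<close> and
  \<open>?h\<close> exchange \<open>j\<close> with the second component \<open>k\<close>, so the two
  cardinalities agree.\<close>

lemma fps_nth_lambert_3_34_68:
  assumes N: "N mod 34 = 28"
  shows "fps_nth (lambert 3 34 68) N = 0"
proof -
  let ?A = "{(n, k). 3 * n + 34 * k + 68 * n * k = N}"
  let ?B = "{(n, k). 68 * Suc n * Suc k = N + 3 * Suc n + 34 * Suc k}"
  let ?g = "\<lambda>(n, k). (1 + 34 * k, (n - 32) div 34)" and ?h = "\<lambda>(n, k). (32 + 34 * k, (n - 1) div 34)"
  \<comment> \<open>23 is the inverse of 3 modulo 34, since \<open>69 = 2 * 34 + 1\<close>.\<close>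
  have inv_mod: "n mod 34 = (23 * (3 * n)) mod 34" for n :: nat
  proof -
    have "23 * (3 * n) = n + 34 * (2 * n)" by simp
    then show ?thesis by (simp only: mod_mult_self2)
  qed
  have A: "\<exists>j. n = 32 + 34 * j" if "(n, k) \<in> ?A" for n k
  proof -
    have "3 * n + 34 * (k + 2 * n * k) = N" using that by simp
    then have "(3 * n) mod 34 = 28" using N by (metis mod_mult_self2)
    then have "n mod 34 = (23 * 28) mod 34" unfolding inv_mod[of n] by (metis mod_mult_right_eq)
    then have "n mod 34 = 32" by simp
    then show ?thesis by (metis mult_div_mod_eq add.commute)
  qed
  have B: "\<exists>j. n = 1 + 34 * j" if "(n, k) \<in> ?B" for n k
  proof -
    have "34 * (2 * Suc n * Suc k) = N + 3 * Suc n + 34 * Suc k" using that by (simp add: algebra_simps)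
    then have "(N + 3 * Suc n) mod 34 = 0" by (metis mod_mult_self2 mod_mult_self1_is_0)
    \<comment> \<open>31 is 28, the residue of \<open>N\<close>, plus the 3 from
      \<open>3 * Suc n\<close>; adding 3 more completes it to 34.\<close>
    then have "(3 * n + 31) mod 34 = 0" using N mod_add_left_eq[of N 34 "3 * Suc n"] by (simp add: add.commute)
    then have "(3 * n + 31 + 3) mod 34 = 3" by (subst mod_add_left_eq[symmetric]) simp
    then have "(3 * n) mod 34 = 3" by simp
    then have "n mod 34 = (23 * 3) mod 34" unfolding inv_mod[of n] by (metis mod_mult_right_eq)
    then have "n mod 34 = 1" by simp
    then show ?thesis by (metis mult_div_mod_eq add.commute)
  qed
  have "bij_betw ?g ?A ?B"
  proof (rule bij_betw_byWitness[of _ ?h])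
    show "\<forall>p\<in>?A. ?h (?g p) = p" "?g ` ?A \<subseteq> ?B" using A by (fastforce simp: algebra_simps)+
    show "\<forall>p\<in>?B. ?g (?h p) = p" "?h ` ?B \<subseteq> ?A" using B by (fastforce simp: algebra_simps)+
  qed
  then show ?thesis
    by (simp only: lambert_def fps_nth_Abs_fps bij_betw_same_card diff_self)
qed

theorem theorem3p2:
  fixes \<xi> :: "nat \<Rightarrow> int"
  assumes "qpoch_inf2 (fps_X ^ 31) (fps_X ^ 37) (fps_X ^ 68)
             / qpoch_inf2 (fps_X ^ 3) (fps_X ^ 65) (fps_X ^ 68)
           = (Abs_fps (\<lambda>n. of_int (\<xi> n)) :: rat fps)"
  shows "\<forall>n. \<xi> (34 * n + 28) = 0"
proof
  fix n
  define F :: "rat fps" where "F = Abs_fps (\<lambda>n. of_int (\<xi> n))"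
  define q :: "rat fps" where "q = fps_X ^ 68"
  define D where "D = qpoch_inf2 (fps_X ^ 3) (fps_X ^ 65) q"
  define E where "E = qpoch_inf2 (fps_X ^ 34) (fps_X ^ 34) q"
  define J where "J = qpoch_inf q q"
  have D0: "fps_nth D 0 = 1" and J0: "fps_nth J 0 = 1"
    by (simp_all add: D_def J_def q_def qpoch_inf2_def fps_nth_0_qpoch_inf)
  have "F = qpoch_inf2 (fps_X ^ 31) (fps_X ^ 37) q / D"
    using assms by (simp add: F_def q_def D_def)
  then have FD: "F * D = qpoch_inf2 (fps_X ^ 31) (fps_X ^ 37) q"
    using D0 by (simp add: fps_divide_unit mult.assoc inverse_mult_eq_1)
  have "D * (F * J ^ 2) = F * D * J ^ 2" by (simp only: mult_ac)
  \<comment> \<open>The factors are swapped because the identity lists the exponent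
    \<open>a + b = 37\<close> first and \<open>68 - 37 = 31\<close> second.\<close>
  also have "F * D = qpoch_inf2 (fps_X ^ 37) (fps_X ^ 31) q"
    unfolding FD qpoch_inf2_def by (rule mult.commute)
  also have "\<dots> * J ^ 2 = D * E * lambert 3 34 68"
    using lambert_series_identity[of 3 34 68, where 'a = rat] by (simp add: D_def E_def J_def q_def)
  finally have "D * (F * J ^ 2) = D * (lambert 3 34 68 * E)" by (simp only: mult_ac)
  then have FJ: "F * J ^ 2 = lambert 3 34 68 * E"
    using D0 by auto
  \<comment> \<open>All exponents in the products for \<open>E\<close> and \<open>J\<close> are
    multiples of 34. Hence multiplication by \<open>E\<close> preserves the vanishing class of the
    Lambert series, and \<open>J ^ 2\<close>, with constant term 1, can be cancelled without leaving
    that class.\<close>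
  have E: "fps_nth E k = 0" and J: "fps_nth (J ^ 2) k = 0" if "\<not> 34 dvd k" for k
    unfolding E_def J_def q_def qpoch_inf2_def power2_eq_square
    using that by (auto intro!: fps_nth_mult_not_dvd[of 34] fps_nth_qpoch_inf_not_dvd[of _ _ 34])
  have "fps_nth F (34 * n + 28) = 0"
  proof (rule fps_nth_residue_zero_cancel[of 34 28 F "J ^ 2"])
    show "fps_nth (F * J ^ 2) k = 0" if "k mod 34 = 28" for k
      unfolding FJ using fps_nth_lambert_3_34_68 E that by (rule fps_mult_nth_residue_zero)
  qed (use J J0 in \<open>simp_all add: power2_eq_square\<close>)
  then show "\<xi> (34 * n + 28) = 0" by (simp add: F_def)
qed

end
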